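(* Let $d\ge1$ be an integer. Suppose that every cosimple zonotope with generators in $\mathbb{Z}^{d-1}$ has covering radius at most $\frac{d-1}{d+1}$. Then: (a) every Strong Lonely Runner Zonotope $Z\subseteq\mathbb{R}^d$ with $\mu(Z)>\frac{d}{d+2}$ contains at most $\binom{d+2}{2}^d$ points of $\mathbb{Z}^d$; and (b) every Lonely Runner Zonotope $Z\subseteq\mathbb{R}^d$ with center $\mathbf x$ such that $\frac{d}{d+2}(Z-\mathbf x)\cap(\mathbf x+\mathbb{Z}^d)=\varnothing$ contains at most $\binom{d+2}{2}^d$ points of $\mathbb{Z}^d$.
   Context: A finite collection of vectors $\mathbf u_1,\dots,\mathbf u_n\in\mathbb{Z}^d$ that linearly spans $\mathbb{R}^d$ is cosimple if there is a linear dependence $\sum_i\lambda_i\mathbf u_i=\mathbf 0$ whose coefficients are all non-zero and have pairwise different absolute values; a cosimple zonotope is a zonotope $\sum_i[\mathbf 0,\mathbf u_i]$ generated by a cosimple collection. The covering radius of a convex body $M\subseteq\mathbb{R}^d$ is $\mu(M)=\min\{\rho>0:\rho M+\mathbb{Z}^d=\mathbb{R}^d\}$. A Lonely Runner Zonotope in $\mathbb{R}^d$ is a zonotope $Z=\sum_{i=1}^{d+1}[\mathbf 0,\mathbf u_i]$ with $d+1$ generators $\mathbf u_i\in\mathbb{Z}^d$, every $d$ of which are linearly independent; its center is $\mathbf x=\frac12\sum_i\mathbf u_i$. For $\mathbf v=(v_1,\dots,v_{d+1})\in\mathbb{Z}_{>0}^{d+1}$ with $\gcd(v_1,\dots,v_{d+1})=1$,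 let $Z_{\mathbf v}=\sum_{i=1}^{d+1}[\mathbf 0,\mathbf u_i]$, where $\mathbf u_1,\dots,\mathbf u_{d+1}$ generate $\mathbb{Z}^d$ as a lattice and $\sum_iv_i\mathbf u_i=\mathbf 0$ (unique up to unimodular equivalence). A Strong Lonely Runner Zonotope is a $Z_{\mathbf v}$ for which the entries of $\mathbf v$ are pairwise distinct. *)

theory Defs
  imports "Jordan_Normal_Form.VS_Connect"
begin

text \<open>
  The space \<open>\<real>\<^sup>d\<close> is \<open>carrier_vec d :: real vec set\<close>; this allows \<open>d = 0\<close> and lets the
  dimension vary inside one statement. A collection of \<open>n\<close> vectors is a family
  \<open>u :: nat \<Rightarrow> real vec\<close> of which only the values \<open>u i\<close> with \<open>i < n\<close> are relevant;
  repetitions are allowed.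
\<close>

definition int_lattice :: "nat \<Rightarrow> real vec set" where
  "int_lattice d = {x \<in> carrier_vec d. \<forall>i<d. x $ i \<in> \<int>}"

definition lin_comb :: "nat \<Rightarrow> nat \<Rightarrow> (nat \<Rightarrow> real) \<Rightarrow> (nat \<Rightarrow> real vec) \<Rightarrow> real vec" where
  "lin_comb d n c u = finsum_vec TYPE(real) d (\<lambda>i. c i \<cdot>\<^sub>v u i) {..<n}"

abbreviation vspan :: "nat \<Rightarrow> real vec set \<Rightarrow> real vec set" where
  "vspan d \<equiv> LinearCombinations.module.span class_ring (module_vec TYPE(real) d)"

abbreviation vlin_indpt :: "nat \<Rightarrow> real vec set \<Rightarrow> bool" where
  "vlin_indpt d S \<equiv> \<not> LinearCombinations.module.lin_dep class_ring (module_vec TYPE(real) d) S"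

text \<open>The Minkowski sum of the segments \<open>[0, u i]\<close> for \<open>i < n\<close>.\<close>

definition zonotope :: "nat \<Rightarrow> nat \<Rightarrow> (nat \<Rightarrow> real vec) \<Rightarrow> real vec set" where
  "zonotope d n u = {lin_comb d n t u | t. \<forall>i<n. 0 \<le> t i \<and> t i \<le> 1}"

definition zonotope_center :: "nat \<Rightarrow> nat \<Rightarrow> (nat \<Rightarrow> real vec) \<Rightarrow> real vec" where
  "zonotope_center d n u = (1/2) \<cdot>\<^sub>v lin_comb d n (\<lambda>_. 1) u"

text \<open>
  For a convex body with nonempty interior in dimension \<open>d > 0\<close> the infimum is a minimum.
  In dimension \<open>0\<close> every \<open>\<rho> > 0\<close> is admissible, there is no minimum, and the covering
  radius of the point is \<open>0\<close>.
\<close>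

definition covering_radius :: "nat \<Rightarrow> real vec set \<Rightarrow> real" where
  "covering_radius d M =
     Inf {\<rho>. \<rho> > 0 \<and> {\<rho> \<cdot>\<^sub>v m + z | m z. m \<in> M \<and> z \<in> int_lattice d} = carrier_vec d}"

definition cosimple :: "nat \<Rightarrow> nat \<Rightarrow> (nat \<Rightarrow> real vec) \<Rightarrow> bool" where
  "cosimple d n u \<longleftrightarrow>
     (\<forall>i<n. u i \<in> int_lattice d) \<and>
     vspan d (u ` {..<n}) = carrier_vec d \<and>
     (\<exists>c. lin_comb d n c u = 0\<^sub>v d \<and> (\<forall>i<n. c i \<noteq> 0) \<and> inj_on (\<lambda>i. \<bar>c i\<bar>) {..<n})"

text \<open>
  Independence of the subfamily \<open>(u i)\<^sub>i\<^sub>\<in>\<^sub>J\<close> means injectivity on \<open>J\<close> together with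
  independence of the set of its members.
\<close>

definition lonely_runner_generators :: "nat \<Rightarrow> (nat \<Rightarrow> real vec) \<Rightarrow> bool" where
  "lonely_runner_generators d u \<longleftrightarrow>
     (\<forall>i<d+1. u i \<in> int_lattice d) \<and>
     (\<forall>J. J \<subseteq> {..<d+1} \<and> card J = d \<longrightarrow> inj_on u J \<and> vlin_indpt d (u ` J))"

text \<open>
  The generating families of \<open>Z\<^sub>v\<close>, that is, all its representatives up to unimodular
  equivalence.
\<close>

definition velocity_generators :: "nat \<Rightarrow> (nat \<Rightarrow> int) \<Rightarrow> (nat \<Rightarrow> real vec) \<Rightarrow> bool" where
  "velocity_generators d v u \<longleftrightarrow>
     (\<forall>i<d+1. u i \<in> int_lattice d) \<and>
     {lin_comb d (d+1) (\<lambda>i. of_int (c i)) u | c :: nat \<Rightarrow> int. True} = int_lattice d \<and>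
     lin_comb d (d+1) (\<lambda>i. of_int (v i)) u = 0\<^sub>v d"

definition strong_lonely_runner_zonotope :: "nat \<Rightarrow> real vec set \<Rightarrow> bool" where
  "strong_lonely_runner_zonotope d Z \<longleftrightarrow>
     (\<exists>v u. (\<forall>i<d+1. v i > 0) \<and> Gcd (v ` {..<d+1}) = 1 \<and> inj_on v {..<d+1} \<and>
            velocity_generators d v u \<and> Z = zonotope d (d+1) u)"

definition lonely_runner_zonotope :: "nat \<Rightarrow> real vec set \<Rightarrow> real vec \<Rightarrow> bool" where
  "lonely_runner_zonotope d Z x \<longleftrightarrow>
     (\<exists>u. lonely_runner_generators d u \<and> Z = zonotope d (d+1) u \<and> x = zonotope_center d (d+1) u)"

text \<open>Finiteness is stated explicitly because \<open>card\<close> is \<open>0\<close> on infinite sets.\<close>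

definition at_most_lattice_points :: "nat \<Rightarrow> real vec set \<Rightarrow> nat \<Rightarrow> bool" where
  "at_most_lattice_points d Z N \<longleftrightarrow> finite (Z \<inter> int_lattice d) \<and> card (Z \<inter> int_lattice d) \<le> N"

end

theory Submission
  imports Defs
begin

text \<open>
  With \<open>N\<close> the binomial coefficient \<open>d + 2\<close> over \<open>2\<close>, we have
  \<open>d / (d + 2) = (d - 1) / (d + 1) + 1 / N\<close>. A zonotope with more than \<open>N ^ d\<close> lattice points
  contains two that agree modulo \<open>N\<close>, hence a segment \<open>[p, p + N w]\<close> with \<open>w\<close> a nonzero lattice
  vector. Projecting along \<open>w\<close> gives a zonotope in dimension \<open>d - 1\<close>, and a covering of the
  projection with radius \<open>\<rho>\<close> lifts to a covering with radius \<open>\<rho> + 1 / N\<close>, because a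
  \<open>1 / N\<close>-fraction of the segment covers every fiber modulo \<open>w\<close>.

  For distinct velocities the projection is cosimple, since the dependence of the generators
  persists. For (b) only the center has to be covered, so generators whose coefficients have equal
  absolute values can be merged until the coefficients are distinct; the merged family need not
  span, but it extends to a spanning cosimple one without affecting coverings of its own span.
\<close>

section \<open>Quotients of the integer lattice\<close>

text \<open>Vectors are plain coordinate functions here, of which only the values below the
  dimension matter. This lets the dimension drop under projection without conversions, and explains
  why conditions on coordinates range over \<open>j < D\<close>.\<close>

definition dotp :: "nat \<Rightarrow> (nat \<Rightarrow> real) \<Rightarrow> (nat \<Rightarrow> real) \<Rightarrow> real" where
  "dotp D a x = (\<Sum>j<D. a j * x j)"

definition in_span :: "nat \<Rightarrow> nat \<Rightarrow> (nat \<Rightarrow> nat \<Rightarrow> real) \<Rightarrow> (nat \<Rightarrow> real) \<Rightarrow> bool" where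
  "in_span D n u x \<longleftrightarrow> (\<exists>c. \<forall>j<D. x j = (\<Sum>i<n. c i * u i j))"

definition int_family :: "nat \<Rightarrow> nat \<Rightarrow> (nat \<Rightarrow> nat \<Rightarrow> real) \<Rightarrow> bool" where
  "int_family D n u \<longleftrightarrow> (\<forall>i<n. \<forall>j<D. u i j \<in> \<int>)"

text \<open>Distinctness of the absolute values is kept separate, because part (b) starts from a
  dependence without it.\<close>

definition dependence :: "nat \<Rightarrow> nat \<Rightarrow> (nat \<Rightarrow> nat \<Rightarrow> real) \<Rightarrow> (nat \<Rightarrow> real) \<Rightarrow> bool" where
  "dependence D n u c \<longleftrightarrow> (\<forall>j<D. (\<Sum>i<n. c i * u i j) = 0) \<and> (\<forall>i<n. c i \<noteq> 0)"

text \<open>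
  The point \<open>y\<close> lies in a lattice translate of \<open>\<rho> * Z\<close>, where the zonotope \<open>Z\<close> is centered at
  the origin.
\<close>

definition covered :: "nat \<Rightarrow> nat \<Rightarrow> (nat \<Rightarrow> nat \<Rightarrow> real) \<Rightarrow> real \<Rightarrow> (nat \<Rightarrow> real) \<Rightarrow> bool" where
  "covered D n u \<rho> y \<longleftrightarrow>
     (\<exists>t. (\<forall>i<n. \<bar>t i\<bar> \<le> 1/2) \<and> (\<forall>j<D. y j - \<rho> * (\<Sum>i<n. t i * u i j) \<in> \<int>))"

text \<open>
  The map sending \<open>x\<close> to the tuple of the \<open>dotp D (a k) x\<close> with \<open>k < r\<close> has kernel the span of
  \<open>u\<close> and maps the lattice onto the integral tuples, with section given by the vectors \<open>e k\<close>.
\<close>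

definition quotient_data ::
  "nat \<Rightarrow> nat \<Rightarrow> (nat \<Rightarrow> nat \<Rightarrow> real) \<Rightarrow> nat \<Rightarrow> (nat \<Rightarrow> nat \<Rightarrow> real) \<Rightarrow> (nat \<Rightarrow> nat \<Rightarrow> real) \<Rightarrow> bool" where
  "quotient_data D n u r a e \<longleftrightarrow>
     (\<forall>k<r. \<forall>j<D. a k j \<in> \<int> \<and> e k j \<in> \<int>) \<and>
     (\<forall>k<r. \<forall>l<r. dotp D (a k) (e l) = (if k = l then 1 else 0)) \<and>
     (\<forall>k<r. \<forall>i<n. dotp D (a k) (u i) = 0) \<and>
     (\<forall>x. (\<forall>k<r. dotp D (a k) x = 0) \<longrightarrow> in_span D n u x)"

lemma dotp_cong: "(\<And>j. j < D \<Longrightarrow> x j = y j) \<Longrightarrow> dotp D a x = dotp D a y"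
  by (simp add: dotp_def)

lemma dotp_add: "dotp D a (\<lambda>j. x j + y j) = dotp D a x + dotp D a y"
  by (simp add: dotp_def algebra_simps sum.distrib)

lemma dotp_diff: "dotp D a (\<lambda>j. x j - y j) = dotp D a x - dotp D a y"
  by (simp add: dotp_def algebra_simps sum_subtractf)

lemma dotp_cmult: "dotp D a (\<lambda>j. s * x j) = s * dotp D a x"
  by (simp add: dotp_def algebra_simps sum_distrib_left)

lemma dotp_diff_left: "dotp D (\<lambda>j. a j - s * b j) x = dotp D a x - s * dotp D b x"
  by (simp add: dotp_def algebra_simps sum_subtractf sum_distrib_left)

lemma dotp_sum: "dotp D a (\<lambda>j. \<Sum>i\<in>I. c i * u i j) = (\<Sum>i\<in>I. c i * dotp D a (u i))"
  unfolding dotp_def sum_distrib_left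
  by (subst sum.swap) (simp add: algebra_simps)

lemma dotp_Ints: "(\<And>j. j < D \<Longrightarrow> a j \<in> \<int>) \<Longrightarrow> (\<And>j. j < D \<Longrightarrow> x j \<in> \<int>) \<Longrightarrow> dotp D a x \<in> \<int>"
  unfolding dotp_def by (intro Ints_sum Ints_mult) auto

lemma abs_sum_ge_member:
  fixes c :: "nat \<Rightarrow> real"
  shows "i < n \<Longrightarrow> \<bar>c i\<bar> \<le> (\<Sum>i<n. \<bar>c i\<bar>)"
  by (rule member_le_sum) auto

lemma quotient_data_in_span:
  "quotient_data D n u r a e \<Longrightarrow> (\<And>k. k < r \<Longrightarrow> dotp D (a k) x = 0) \<Longrightarrow> in_span D n u x"
  unfolding quotient_data_def by blast

text \<open>Subtracting \<open>s\<close> times \<open>a l\<close> from \<open>a k\<close> is an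
  invertible row operation. The vectors \<open>e\<close> change by the inverse transpose, which
  keeps the two families dual, and \<open>s \<in> \<int>\<close> keeps both integral.\<close>

lemma quotient_data_shear:
  assumes q: "quotient_data D n u r a e" and kl: "k < r" "l < r" "k \<noteq> l" and s: "s \<in> \<int>"
  shows "quotient_data D n u r (a(k := \<lambda>j. a k j - s * a l j)) (e(l := \<lambda>j. e l j + s * e k j))"
    (is "quotient_data D n u r ?a ?e")
proof -
  have "\<forall>m<r. \<forall>j<D. ?a m j \<in> \<int> \<and> ?e m j \<in> \<int>"
    using q kl s unfolding quotient_data_def by (auto intro!: Ints_diff Ints_add Ints_mult)
  moreover have "\<forall>m<r. \<forall>p<r. dotp D (?a m) (?e p) = (if m = p then 1 else 0)"
    using q kl unfolding quotient_data_def
    by (auto simp: dotp_diff_left dotp_add dotp_cmult)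
  moreover have "\<forall>m<r. \<forall>i<n. dotp D (?a m) (u i) = 0"
    using q kl unfolding quotient_data_def by (auto simp: dotp_diff_left)
  moreover have "in_span D n u x" if x: "\<forall>m<r. dotp D (?a m) x = 0" for x
  proof -
    have l: "dotp D (a l) x = 0" using x[rule_format, OF kl(2)] kl by simp
    have "dotp D (a m) x = 0" if "m < r" for m
      using x[rule_format, OF that] l by (cases "m = k") (auto simp: dotp_diff_left)
    then show ?thesis using q unfolding quotient_data_def by blast
  qed
  ultimately show ?thesis unfolding quotient_data_def by blast
qed

lemma quotient_data_swap:
  assumes q: "quotient_data D n u r a e" and kl: "k < r" "l < r"
  shows "quotient_data D n u r (a \<circ> Transposition.transpose k l) (e \<circ> Transposition.transpose k l)"
    (is "quotient_data D n u r (a \<circ> ?\<tau>) _")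
proof -
  have less: "?\<tau> m < r \<longleftrightarrow> m < r" for m using kl by (auto simp: transpose_def)
  have inv: "?\<tau> (?\<tau> m) = m" for m by simp
  have "in_span D n u x" if x: "\<forall>m<r. dotp D ((a \<circ> ?\<tau>) m) x = 0" for x
  proof -
    have "dotp D (a m) x = 0" if "m < r" for m
      using x[rule_format, of "?\<tau> m"] that less inv by simp
    then show ?thesis using q unfolding quotient_data_def by blast
  qed
  then show ?thesis
    using q less unfolding quotient_data_def by (auto simp: transpose_eq_iff)
qed

text \<open>Euclid's algorithm on the coordinates of \<open>w\<close> in the quotient lattice.\<close>

lemma quotient_data_concentrate:
  assumes "quotient_data D n u r a e" and w: "\<And>j. j < D \<Longrightarrow> w j \<in> \<int>"
  shows "\<exists>a e. quotient_data D n u r a e \<and>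
           (\<forall>k<r. \<forall>l<r. dotp D (a k) w \<noteq> 0 \<and> dotp D (a l) w \<noteq> 0 \<longrightarrow> k = l)"
  using assms(1)
proof (induction "nat \<lfloor>\<Sum>k<r. \<bar>dotp D (a k) w\<bar>\<rfloor>" arbitrary: a e rule: less_induct)
  case less
  let ?g = "\<lambda>k. dotp D (a k) w"
  have gint: "?g k \<in> \<int>" if "k < r" for k
    using less.prems w that unfolding quotient_data_def by (intro dotp_Ints) auto
  show ?case
  proof (cases "\<forall>k<r. \<forall>l<r. ?g k \<noteq> 0 \<and> ?g l \<noteq> 0 \<longrightarrow> k = l")
    case True
    then show ?thesis using less.prems by blast
  next
    case False
    then obtain k l where kl: "k < r" "l < r" "k \<noteq> l" "?g k \<noteq> 0" "?g l \<noteq> 0" "\<bar>?g l\<bar> \<le> \<bar>?g k\<bar>"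
      by (metis linorder_le_cases)
    \<comment> \<open>This sign makes the subtraction shrink the larger entry by exactly the
      absolute value of the smaller one, so the integral sum of absolute values falls by at least
      1.\<close>
    define s where "s = sgn (?g k) * sgn (?g l)"
    have s: "s \<in> \<int>" using kl by (auto simp: s_def sgn_if)
    have le: "\<bar>?g k - s * ?g l\<bar> = \<bar>?g k\<bar> - \<bar>?g l\<bar>"
      using kl by (auto simp: s_def sgn_if abs_if split: if_splits)
    let ?a = "a(k := \<lambda>j. a k j - s * a l j)"
    let ?S = "\<Sum>m<r. \<bar>?g m\<bar>" and ?S' = "\<Sum>m<r. \<bar>dotp D (?a m) w\<bar>"
    have "?S = \<bar>?g k\<bar> + (\<Sum>m\<in>{..<r}-{k}. \<bar>?g m\<bar>)"
      using kl by (subst sum.remove[of _ k]) auto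
    moreover have "?S' = \<bar>?g k - s * ?g l\<bar> + (\<Sum>m\<in>{..<r}-{k}. \<bar>?g m\<bar>)"
      using kl by (subst sum.remove[of _ k]) (auto simp: dotp_diff_left)
    ultimately have "?S' = ?S - \<bar>?g l\<bar>" using le by simp
    moreover have "\<bar>?g l\<bar> \<ge> 1" using gint[OF kl(2)] kl(5) by (auto elim!: Ints_cases)
    moreover have "?S' \<ge> 0" by (rule sum_nonneg) simp
    ultimately have "nat \<lfloor>?S'\<rfloor> < nat \<lfloor>?S\<rfloor>" by linarith
    from less.hyps[OF this quotient_data_shear[OF less.prems kl(1-3) s]] show ?thesis .
  qed
qed

lemma quotient_data_Suc:
  assumes "quotient_data D n u r a e" and w: "\<And>j. j < D \<Longrightarrow> u n j \<in> \<int>"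
    and nspan: "\<not> in_span D n u (u n)"
  shows "\<exists>a e. quotient_data D (Suc n) u (r - 1) a e"
proof -
  obtain a e where q: "quotient_data D n u r a e"
    and uniq: "\<And>k l. k < r \<Longrightarrow> l < r \<Longrightarrow> dotp D (a k) (u n) \<noteq> 0 \<Longrightarrow> dotp D (a l) (u n) \<noteq> 0 \<Longrightarrow> k = l"
    using quotient_data_concentrate[OF assms(1), of "u n"] w by blast
  obtain k0 where k0: "k0 < r" "dotp D (a k0) (u n) \<noteq> 0"
    using q nspan unfolding quotient_data_def by blast
  define b f where "b = a \<circ> Transposition.transpose k0 (r - 1)" and "f = e \<circ> Transposition.transpose k0 (r - 1)"
  have qb: "quotient_data D n u r b f"
    unfolding b_def f_def using k0 by (intro quotient_data_swap[OF q]) auto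
  have last: "dotp D (b (r - 1)) (u n) \<noteq> 0" using k0 by (simp add: b_def)
  have zero: "dotp D (b k) (u n) = 0" if "k < r - 1" for k
  proof -
    have "Transposition.transpose k0 (r - 1) k < r" "Transposition.transpose k0 (r - 1) k \<noteq> k0"
      using that k0 by (auto simp: transpose_def)
    then show ?thesis using uniq[of "Transposition.transpose k0 (r - 1) k" k0] k0 by (auto simp: b_def)
  qed
  have "in_span D (Suc n) u x" if x: "\<forall>k<r-1. dotp D (b k) x = 0" for x
  proof -
    define s where "s = dotp D (b (r - 1)) x / dotp D (b (r - 1)) (u n)"
    have "dotp D (b k) (\<lambda>j. x j - s * u n j) = 0" if "k < r" for k
    proof (cases "k = r - 1")
      case True
      then show ?thesis unfolding dotp_diff dotp_cmult using last by (simp add: s_def)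
    next
      case False
      then have "k < r - 1" using that by simp
      then show ?thesis using x zero by (simp add: dotp_diff dotp_cmult)
    qed
    from quotient_data_in_span[OF qb this]
    obtain c where c: "\<forall>j<D. x j - s * u n j = (\<Sum>i<n. c i * u i j)"
      unfolding in_span_def by blast
    have "\<forall>j<D. x j = (\<Sum>i<Suc n. (c(n := s)) i * u i j)"
      using c by (auto simp: algebra_simps)
    then show ?thesis unfolding in_span_def by blast
  qed
  then have "quotient_data D (Suc n) u (r - 1) b f"
    using qb zero unfolding quotient_data_def by (auto simp: less_Suc_eq)
  then show ?thesis by blast
qed

lemma quotient_data_0: "quotient_data D 0 u D (\<lambda>k j. if j = k then 1 else 0) (\<lambda>k j. if j = k then 1 else 0)"
  unfolding quotient_data_def in_span_def dotp_def
  by (auto simp: if_distrib[where f="\<lambda>x. x * _"] if_distrib[where f="\<lambda>x. _ * x"] cong: if_cong)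

text \<open>Generators are added one at a time: one outside the current span costs a functional, one
  inside leaves the data valid. The corank \<open>r\<close> may stay unspecified, since
  \<open>covered_in_span\<close> treats every value of it.\<close>

lemma quotient_data_exists:
  "int_family D n u \<Longrightarrow> \<exists>r a e. quotient_data D n u r a e"
proof (induction n)
  case 0
  then show ?case using quotient_data_0 by blast
next
  case (Suc n)
  then obtain r a e where q: "quotient_data D n u r a e" unfolding int_family_def by force
  show ?case
  proof (cases "in_span D n u (u n)")
    case False
    then show ?thesis using quotient_data_Suc[OF q] Suc.prems unfolding int_family_def by blast
  next
    case True
    then obtain c where c: "\<forall>j<D. u n j = (\<Sum>i<n. c i * u i j)" unfolding in_span_def by blast
    have z: "dotp D (a k) (u n) = 0" if "k < r" for k
    proof -
      have "dotp D (a k) (u n) = (\<Sum>i<n. c i * dotp D (a k) (u i))"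
        unfolding dotp_sum[symmetric] using c by (intro dotp_cong) auto
      then show ?thesis using q that unfolding quotient_data_def by simp
    qed
    have sp: "in_span D (Suc n) u x" if x: "in_span D n u x" for x
    proof -
      obtain c' where "\<forall>j<D. x j = (\<Sum>i<n. c' i * u i j)" using x unfolding in_span_def by blast
      then have "\<forall>j<D. x j = (\<Sum>i<Suc n. (c'(n := 0)) i * u i j)" by simp
      then show ?thesis unfolding in_span_def by blast
    qed
    have "quotient_data D (Suc n) u r a e"
      using q z sp unfolding quotient_data_def by (auto simp: less_Suc_eq)
    then show ?thesis by blast
  qed
qed

section \<open>Coverings by families that do not span\<close>

text \<open>The hypothesis on cosimple zonotopes, freed of the infimum in
  \<open>covering_radius\<close> and of the type of vectors, so that it applies directly to
  projected families and to single points.\<close>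

definition spanning_covers :: "nat \<Rightarrow> real \<Rightarrow> bool" where
  "spanning_covers D \<rho> \<longleftrightarrow>
     (\<forall>n u c y. int_family D n u \<and> (\<forall>x. in_span D n u x) \<and> dependence D n u c \<and>
        inj_on (\<lambda>i. \<bar>c i\<bar>) {..<n} \<longrightarrow> covered D n u \<rho> y)"

lemma coveredI:
  assumes "\<And>i. i < n \<Longrightarrow> \<bar>t i\<bar> \<le> 1/2"
    and "\<And>j. j < D \<Longrightarrow> y j - \<rho> * (\<Sum>i<n. t i * u i j) \<in> \<int>"
  shows "covered D n u \<rho> y"
  unfolding covered_def using assms by (intro exI[of _ t]) simp

text \<open>Induction on the corank \<open>r\<close>. For \<open>r = 0\<close> the family spans and
  \<open>H\<close> applies; otherwise the family is enlarged to span one more dimension, in such a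
  way that a covering by the larger family restricts to the old one.\<close>

lemma covered_in_span:
  assumes H: "spanning_covers D \<rho>"
    and "quotient_data D n u r a e" "int_family D n u" "dependence D n u c"
      "inj_on (\<lambda>i. \<bar>c i\<bar>) {..<n}" "in_span D n u x"
  shows "covered D n u \<rho> x"
  using assms(2-)
proof (induction r arbitrary: n u c)
  case 0
  then have "\<forall>x. in_span D n u x" unfolding quotient_data_def by simp
  with 0 H show ?case unfolding spanning_covers_def by blast
next
  case (Suc r)
  note q = Suc.prems(1)
  text \<open>
    Three copies of \<open>e r\<close> enlarge the span by one dimension and carry the dependence
    \<open>M - 3 M + 2 M = 0\<close>; the functional \<open>a r\<close> forces their total contribution to a
    covering of a point of the old span to be an integral multiple of \<open>e r\<close>.
\<close>
  define M where "M = 1 + (\<Sum>i<n. \<bar>c i\<bar>)"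
  have Mpos: "M > 0" unfolding M_def by (smt (verit) sum_nonneg abs_ge_zero)
  have M: "\<bar>c i\<bar> < M" if "i < n" for i using abs_sum_ge_member[OF that, of c] by (simp add: M_def)
  define u' where "u' i = (if i < n then u i else e r)" for i
  define c' where "c' i = (if i < n then c i else if i = n then M else if i = n + 1 then 2 * M else - 3 * M)" for i
  have u'[simp]: "i < n \<Longrightarrow> u' i = u i" "u' n = e r" "u' (Suc n) = e r" "u' (Suc (Suc n)) = e r" for i
    by (auto simp: u'_def)
  have sum3: "(\<Sum>i<n+3. f i) = (\<Sum>i<n. f i) + f n + f (Suc n) + f (Suc (Suc n))" for f :: "nat \<Rightarrow> real"
    by (simp add: eval_nat_numeral)
  have "in_span D (n+3) u' z" if z: "\<forall>k<r. dotp D (a k) z = 0" for z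
  proof -
    \<comment> \<open>Removing the component of \<open>z\<close> along \<open>e r\<close> makes
      \<open>a r\<close> vanish too, and what remains lies in the old span.\<close>
    define s where "s = dotp D (a r) z"
    have "dotp D (a k) (\<lambda>j. z j - s * e r j) = 0" if "k < Suc r" for k
      using q z that unfolding quotient_data_def
      by (auto simp: dotp_diff dotp_cmult s_def less_Suc_eq)
    from quotient_data_in_span[OF q this]
    obtain b where b: "\<forall>j<D. z j - s * e r j = (\<Sum>i<n. b i * u i j)"
      unfolding in_span_def by blast
    have "z j = (\<Sum>i<n+3. (if i < n then b i else if i = n then s else 0) * u' i j)" if "j < D" for j
      using b that by (simp add: sum3 algebra_simps)
    then have "\<forall>j<D. z j = (\<Sum>i<n+3. (if i < n then b i else if i = n then s else 0) * u' i j)" by simp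
    then show ?thesis
      unfolding in_span_def by (intro exI[of _ "\<lambda>i. if i < n then b i else if i = n then s else 0"])
  qed
  moreover have "\<forall>k<r. \<forall>i<n+3. dotp D (a k) (u' i) = 0"
    using q unfolding quotient_data_def by (auto simp: u'_def)
  ultimately have q': "quotient_data D (n+3) u' r a e"
    using q unfolding quotient_data_def by auto
  have int': "int_family D (n+3) u'"
    using q Suc.prems(2) unfolding quotient_data_def int_family_def by (auto simp: u'_def)
  have dep': "dependence D (n+3) u' c'"
    using Suc.prems(3) Mpos unfolding dependence_def by (auto simp: sum3 c'_def)
  \<comment> \<open>The new absolute values are \<open>M\<close>, \<open>2 * M\<close> and
    \<open>3 * M\<close>, and \<open>M\<close> was chosen above all old ones.\<close>
  have inj': "inj_on (\<lambda>i. \<bar>c' i\<bar>) {..<n+3}"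
  proof (rule inj_onI)
    fix i l assume il: "i \<in> {..<n+3}" "l \<in> {..<n+3}" "\<bar>c' i\<bar> = \<bar>c' l\<bar>"
    consider "i < n" "l < n" | "i < n" "l \<ge> n" | "i \<ge> n" "l < n" | "i \<ge> n" "l \<ge> n" by linarith
    then show "i = l"
    proof cases
      case 1
      then show ?thesis using Suc.prems(4) il by (auto simp: c'_def dest: inj_onD)
    next
      case 2
      then show ?thesis using M[of i] Mpos il by (auto simp: c'_def split: if_splits)
    next
      case 3
      then show ?thesis using M[of l] Mpos il by (auto simp: c'_def split: if_splits)
    next
      case 4
      then show ?thesis using Mpos il by (auto simp: c'_def split: if_splits)
    qed
  qed
  obtain b where b: "\<forall>j<D. x j = (\<Sum>i<n. b i * u i j)" using Suc.prems(5) unfolding in_span_def by blast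
  have "\<forall>j<D. x j = (\<Sum>i<n+3. (if i < n then b i else 0) * u' i j)" using b by (simp add: sum3)
  then have "in_span D (n+3) u' x"
    unfolding in_span_def by (rule exI[of _ "\<lambda>i. if i < n then b i else 0"])
  from Suc.IH[OF q' int' dep' inj' this]
  obtain t where t: "\<forall>i<n+3. \<bar>t i\<bar> \<le> 1/2"
    and tz: "\<forall>j<D. x j - \<rho> * (\<Sum>i<n+3. t i * u' i j) \<in> \<int>" unfolding covered_def by blast
  define T where "T = \<rho> * (t n + t (Suc n) + t (Suc (Suc n)))"
  define z where "z j = x j - \<rho> * (\<Sum>i<n+3. t i * u' i j)" for j
  have z_eq: "z j = x j - \<rho> * (\<Sum>i<n. t i * u i j) - T * e r j" if "j < D" for j
    by (simp add: z_def sum3 T_def algebra_simps)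
  have ax: "dotp D (a r) x = 0"
  proof -
    have "dotp D (a r) x = dotp D (a r) (\<lambda>j. \<Sum>i<n. b i * u i j)" using b by (intro dotp_cong) auto
    then show ?thesis using q unfolding quotient_data_def by (simp add: dotp_sum)
  qed
  have "dotp D (a r) z = dotp D (a r) (\<lambda>j. x j - \<rho> * (\<Sum>i<n. t i * u i j) - T * e r j)"
    by (intro dotp_cong z_eq)
  also have "\<dots> = - T"
    using q ax unfolding quotient_data_def by (simp add: dotp_diff dotp_cmult dotp_sum)
  finally have "T = - dotp D (a r) z" by simp
  moreover have "dotp D (a r) z \<in> \<int>"
    using q tz unfolding quotient_data_def by (intro dotp_Ints) (auto simp: z_def)
  ultimately have "T \<in> \<int>" by simp
  have "x j - \<rho> * (\<Sum>i<n. t i * u i j) \<in> \<int>" if "j < D" for j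
  proof -
    have "z j + T * e r j \<in> \<int>"
      using q tz that \<open>T \<in> \<int>\<close> unfolding quotient_data_def z_def by (intro Ints_add Ints_mult) auto
    then show ?thesis using z_eq[OF that] by simp
  qed
  with t show ?case by (intro coveredI[of n t]) auto
qed

lemma sum_two_distinguished:
  fixes f :: "nat \<Rightarrow> real"
  assumes "i < n" "l < n" "i \<noteq> l"
  shows "(\<Sum>m<n. f m) = f i + f l + (\<Sum>m\<in>{..<n}-{i,l}. f m)"
proof -
  have "(\<Sum>m<n. f m) = f i + (\<Sum>m\<in>{..<n}-{i}. f m)" using assms by (subst sum.remove[of _ i]) auto
  also have "(\<Sum>m\<in>{..<n}-{i}. f m) = f l + (\<Sum>m\<in>{..<n}-{i}-{l}. f m)"
    using assms by (subst sum.remove[of _ l]) auto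
  also have "{..<n}-{i}-{l} = {..<n}-{i,l}" by blast
  finally show ?thesis by simp
qed

lemma covered_shift:
  assumes "covered D n u \<rho> x" "\<And>j. j < D \<Longrightarrow> y j - x j \<in> \<int>"
  shows "covered D n u \<rho> y"
proof -
  obtain t where t: "\<forall>i<n. \<bar>t i\<bar> \<le> 1/2" "\<forall>j<D. x j - \<rho> * (\<Sum>i<n. t i * u i j) \<in> \<int>"
    using assms(1) unfolding covered_def by blast
  have "y j - \<rho> * (\<Sum>i<n. t i * u i j) \<in> \<int>" if "j < D" for j
    using Ints_add[OF t(2)[rule_format, OF that] assms(2)[OF that]] by (simp add: algebra_simps)
  then show ?thesis using t(1) unfolding covered_def by blast
qed

text \<open>
  If \<open>c l = \<epsilon> * c i\<close> with \<open>\<epsilon> = \<plusminus>1\<close>, then \<open>u i\<close> and \<open>u l\<close> may be replaced by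
  \<open>u i + \<epsilon> u l\<close> and \<open>0\<close>: the zonotope shrinks, its center moves by a lattice vector, and
  the coefficient of the zero vector becomes arbitrary.
\<close>

lemma covered_center:
  assumes H: "spanning_covers D \<rho>"
    and "int_family D n u" "dependence D n u c"
  shows "covered D n u \<rho> (\<lambda>j. (\<Sum>i<n. u i j) / 2)"
  using assms(2-)
\<comment> \<open>The measure counts how many distinct absolute values are missing. A merging adds
  the new value \<open>M\<close> and loses none, since index \<open>i\<close> still attains the old
  value of index \<open>l\<close>.\<close>
proof (induction "n - card ((\<lambda>i. \<bar>c i\<bar>) ` {..<n})" arbitrary: u c rule: less_induct)
  case less
  show ?case
  proof (cases "inj_on (\<lambda>i. \<bar>c i\<bar>) {..<n}")
    case True
    obtain r a e where q: "quotient_data D n u r a e"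
      using quotient_data_exists[OF less.prems(1)] by blast
    have "in_span D n u (\<lambda>j. (\<Sum>i<n. u i j) / 2)"
      unfolding in_span_def by (rule exI[of _ "\<lambda>_. 1/2"]) (simp add: sum_divide_distrib)
    then show ?thesis using covered_in_span[OF H q less.prems True] by blast
  next
    case False
    then obtain i l where il: "i < n" "l < n" "i \<noteq> l" "\<bar>c i\<bar> = \<bar>c l\<bar>" unfolding inj_on_def by auto
    define \<epsilon> where "\<epsilon> = c l / c i"
    have ci: "c i \<noteq> 0" using less.prems il unfolding dependence_def by auto
    have eps: "\<epsilon> = 1 \<or> \<epsilon> = -1" using il(4) ci by (auto simp: \<epsilon>_def abs_if divide_simps split: if_splits)
    have cl: "c l = \<epsilon> * c i" using ci by (simp add: \<epsilon>_def)
    define M where "M = 1 + (\<Sum>i<n. \<bar>c i\<bar>)"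
    have Mpos: "M > 0" unfolding M_def by (smt (verit) sum_nonneg abs_ge_zero)
    have M: "\<bar>c i\<bar> < M" if "i < n" for i using abs_sum_ge_member[OF that, of c] by (simp add: M_def)
    define u' where "u' = u(i := \<lambda>k. u i k + \<epsilon> * u l k, l := \<lambda>_. 0)"
    define c' where "c' = c(l := M)"
    have eq: "(\<Sum>m<n. f m * u' m j) = f i * (u i j + \<epsilon> * u l j) + (\<Sum>m\<in>{..<n}-{i,l}. f m * u m j)" for f :: "nat \<Rightarrow> real" and j
      using il by (subst sum_two_distinguished[of i n l]) (auto simp: u'_def intro!: sum.cong)
    have "int_family D n u'"
      using less.prems eps il unfolding int_family_def u'_def by (auto intro!: Ints_add Ints_mult Ints_diff)
    moreover have "dependence D n u' c'"
    proof -
      have "(\<Sum>m<n. c' m * u' m j) = (\<Sum>m<n. c m * u m j)" for j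
        unfolding eq sum_two_distinguished[OF il(1-3)] using il cl
        by (auto simp: c'_def algebra_simps intro!: sum.cong)
      then show ?thesis using less.prems Mpos unfolding dependence_def c'_def by auto
    qed
    moreover have "n - card ((\<lambda>i. \<bar>c' i\<bar>) ` {..<n}) < n - card ((\<lambda>i. \<bar>c i\<bar>) ` {..<n})"
    proof -
      have "(\<lambda>i. \<bar>c' i\<bar>) ` {..<n} = insert M ((\<lambda>i. \<bar>c i\<bar>) ` {..<n})"
      proof -
        have "{..<n} = insert l ({..<n} - {l})" using il by blast
        then have "(\<lambda>i. \<bar>c' i\<bar>) ` {..<n} = insert \<bar>c' l\<bar> ((\<lambda>i. \<bar>c' i\<bar>) ` ({..<n} - {l}))"
          by (metis image_insert)
        also have "(\<lambda>i. \<bar>c' i\<bar>) ` ({..<n} - {l}) = (\<lambda>i. \<bar>c i\<bar>) ` ({..<n} - {l})"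
          by (intro image_cong) (auto simp: c'_def)
        also have "\<bar>c' l\<bar> = M" using Mpos by (simp add: c'_def)
        finally have "(\<lambda>i. \<bar>c' i\<bar>) ` {..<n} = insert M ((\<lambda>i. \<bar>c i\<bar>) ` ({..<n} - {l}))" .
        moreover have "(\<lambda>i. \<bar>c i\<bar>) ` ({..<n} - {l}) = (\<lambda>i. \<bar>c i\<bar>) ` {..<n}"
          using il by (auto simp: image_iff) (metis DiffI empty_iff insert_iff lessThan_iff)
        ultimately show ?thesis by simp
      qed
      moreover have "M \<notin> (\<lambda>i. \<bar>c i\<bar>) ` {..<n}" using M by fastforce
      ultimately have "card ((\<lambda>i. \<bar>c' i\<bar>) ` {..<n}) = Suc (card ((\<lambda>i. \<bar>c i\<bar>) ` {..<n}))" by simp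
      moreover have "card ((\<lambda>i. \<bar>c' i\<bar>) ` {..<n}) \<le> n"
        using card_image_le[of "{..<n}" "\<lambda>i. \<bar>c' i\<bar>"] by simp
      ultimately show ?thesis by linarith
    qed
    ultimately have "covered D n u' \<rho> (\<lambda>j. (\<Sum>i<n. u' i j) / 2)" using less.hyps by blast
    then have "covered D n u \<rho> (\<lambda>j. (\<Sum>i<n. u' i j) / 2)"
    proof -
      assume "covered D n u' \<rho> (\<lambda>j. (\<Sum>i<n. u' i j) / 2)"
      then obtain t where t: "\<forall>i<n. \<bar>t i\<bar> \<le> 1/2"
        "\<forall>j<D. (\<Sum>i<n. u' i j) / 2 - \<rho> * (\<Sum>i<n. t i * u' i j) \<in> \<int>" unfolding covered_def by blast
      \<comment> \<open>A coefficient \<open>t i\<close> on the merged generator is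
        \<open>t i\<close> on \<open>u i\<close> together with \<open>\<epsilon> * t i\<close> on
        \<open>u l\<close>, within the same bounds; the coefficient of the zero vector is
        discarded.\<close>
      have "(\<Sum>m<n. t m * u' m j) = (\<Sum>m<n. (t(l := \<epsilon> * t i)) m * u m j)" for j
        unfolding eq sum_two_distinguished[OF il(1-3)] using il
        by (auto simp: algebra_simps intro!: sum.cong)
      then show ?thesis
        using t eps il unfolding covered_def by (intro exI[of _ "t(l := \<epsilon> * t i)"]) auto
    qed
    then show ?thesis
    proof (rule covered_shift)
      fix j assume j: "j < D"
      have S': "(\<Sum>m<n. u' m j) = u i j + \<epsilon> * u l j + (\<Sum>m\<in>{..<n}-{i,l}. u m j)"
        using eq[of "\<lambda>_. 1" j] by simp
      have S: "(\<Sum>m<n. u m j) = u i j + u l j + (\<Sum>m\<in>{..<n}-{i,l}. u m j)"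
        by (rule sum_two_distinguished[OF il(1-3)])
      \<comment> \<open>For \<open>\<epsilon> = -1\<close> the term \<open>u l\<close> changes sign,
        so the half sums differ by all of \<open>u l\<close>, a lattice vector.\<close>
      have "(\<Sum>m<n. u m j) / 2 - (\<Sum>m<n. u' m j) / 2 = (if \<epsilon> = 1 then 0 else u l j)"
      proof (cases "\<epsilon> = 1")
        case True
        then show ?thesis unfolding S S' by simp
      next
        case False
        then have e: "\<epsilon> = -1" using eps by simp
        show ?thesis unfolding S S' e by (simp add: diff_divide_distrib add_divide_distrib)
      qed
      also have "\<dots> \<in> \<int>" using less.prems(1) il j unfolding int_family_def by auto
      finally show "(\<Sum>m<n. u m j) / 2 - (\<Sum>m<n. u' m j) / 2 \<in> \<int>" .
    qed
  qed
qed

text \<open>The covering downstairs determines \<open>y\<close> up to a lattice vector and a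
  multiple of \<open>w\<close>. Modulo \<open>w\<close> that multiple is at most 1/2 in absolute
  value, which compensates for the bound 1 on \<open>\<alpha>\<close>: the remainder fits into a
  \<open>1 / N\<close>-fraction of the centered zonotope.\<close>

lemma covered_lift:
  assumes q: "quotient_data d 1 (\<lambda>_. w) r a e" and w: "\<forall>j<d. w j \<in> \<int>"
    and N: "N > 0" and \<rho>: "\<rho> \<ge> 0"
    and \<alpha>: "\<forall>i<n. \<bar>\<alpha> i\<bar> \<le> 1" "\<forall>j<d. (\<Sum>i<n. \<alpha> i * u i j) = N * w j"
    and cov: "covered r n (\<lambda>i k. dotp d (a k) (u i)) \<rho> (\<lambda>k. dotp d (a k) y)"
  shows "covered d n u (\<rho> + 1 / N) y"
proof -
  obtain t where t: "\<forall>i<n. \<bar>t i\<bar> \<le> 1/2"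
    and tz: "\<forall>k<r. dotp d (a k) y - \<rho> * (\<Sum>i<n. t i * dotp d (a k) (u i)) \<in> \<int>"
    using cov unfolding covered_def by blast
  define z where "z k = dotp d (a k) y - \<rho> * (\<Sum>i<n. t i * dotp d (a k) (u i))" for k
  \<comment> \<open>The integral remainder \<open>z\<close> is lifted to a lattice vector through
    the section \<open>e\<close>; subtracting it leaves a vector killed by all functionals.\<close>
  define x where "x j = y j - \<rho> * (\<Sum>i<n. t i * u i j) - (\<Sum>l<r. z l * e l j)" for j
  have "dotp d (a k) x = 0" if k: "k < r" for k
  proof -
    have "dotp d (a k) x = z k - (\<Sum>l<r. z l * dotp d (a k) (e l))"
      unfolding x_def by (simp add: dotp_diff dotp_cmult dotp_sum z_def)
    also have "(\<Sum>l<r. z l * dotp d (a k) (e l)) = (\<Sum>l<r. if k = l then z l else 0)"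
      using q k unfolding quotient_data_def by (intro sum.cong) auto
    also have "\<dots> = z k" using k by simp
    finally show ?thesis by simp
  qed
  from quotient_data_in_span[OF q this]
  obtain s where s: "\<forall>j<d. x j = s * w j"
    unfolding in_span_def by auto
  define \<tau> where "\<tau> = s - of_int (round s)"
  have \<tau>: "\<bar>\<tau>\<bar> \<le> 1/2" unfolding \<tau>_def using of_int_round_abs_le[of s] by (simp add: abs_minus_commute)
  \<comment> \<open>The weighted mean of \<open>t i\<close> and \<open>\<tau> * \<alpha> i\<close>
    with weights \<open>\<rho>\<close> and \<open>1 / N\<close>; both are bounded by 1/2.\<close>
  define t' where "t' i = (\<rho> * t i + \<tau> * \<alpha> i / N) / (\<rho> + 1 / N)" for i
  have pos: "\<rho> + 1 / N > 0" using N \<rho> by (simp add: add_nonneg_pos)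
  have "\<bar>t' i\<bar> \<le> 1/2" if i: "i < n" for i
  proof -
    have "\<bar>\<tau> * \<alpha> i\<bar> \<le> 1/2 * 1" unfolding abs_mult using \<tau> \<alpha>(1) i by (intro mult_mono) auto
    then have "\<bar>\<tau> * \<alpha> i\<bar> / N \<le> 1/2 * 1 / N" using N by (intro divide_right_mono) auto
    then have "\<bar>\<tau> * \<alpha> i / N\<bar> \<le> 1/2 * 1 / N" using N by (simp only: abs_divide abs_of_pos)
    then have "\<bar>\<tau> * \<alpha> i / N\<bar> \<le> 1 / N * (1/2)" 
      by (simp only: mult_1_right times_divide_eq_right times_divide_eq_left mult_1_left
          divide_divide_eq_left mult.commute)
    moreover have "\<bar>\<rho> * t i\<bar> \<le> \<rho> * (1/2)"
      using mult_left_mono[of "\<bar>t i\<bar>" "1/2" \<rho>] t i \<rho> by (simp add: abs_mult)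
    ultimately have "\<bar>\<rho> * t i + \<tau> * \<alpha> i / N\<bar> \<le> (\<rho> + 1 / N) * (1/2)"
      unfolding distrib_right by (intro order_trans[OF abs_triangle_ineq] add_mono)
    then show ?thesis using pos by (simp add: t'_def abs_divide divide_simps)
  qed
  moreover have "y j - (\<rho> + 1 / N) * (\<Sum>i<n. t' i * u i j) \<in> \<int>" if j: "j < d" for j
  proof -
    have "(\<rho> + 1 / N) * (\<Sum>i<n. t' i * u i j) = (\<Sum>i<n. (\<rho> * t i + \<tau> * \<alpha> i / N) * u i j)"
      unfolding sum_distrib_left t'_def using pos by (intro sum.cong) auto
    also have "\<dots> = \<rho> * (\<Sum>i<n. t i * u i j) + \<tau> / N * (\<Sum>i<n. \<alpha> i * u i j)"
      by (simp add: sum_distrib_left sum.distrib distrib_right mult.assoc)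
    also have "\<dots> = \<rho> * (\<Sum>i<n. t i * u i j) + \<tau> * w j" using \<alpha>(2) j N by simp
    moreover have "y j - \<rho> * (\<Sum>i<n. t i * u i j) - (\<Sum>l<r. z l * e l j) = s * w j"
      using s[rule_format, OF j] unfolding x_def .
    ultimately have "y j - (\<rho> + 1 / N) * (\<Sum>i<n. t' i * u i j) = of_int (round s) * w j + (\<Sum>l<r. z l * e l j)"
      by (simp add: \<tau>_def left_diff_distrib)
    also have "\<dots> \<in> \<int>"
      using q w tz j unfolding quotient_data_def z_def by (auto intro!: Ints_add Ints_mult Ints_sum)
    finally show ?thesis .
  qed
  ultimately show ?thesis by (rule coveredI)
qed

section \<open>Covering radii\<close>

text \<open>Bolzano-Weierstrass, by refining to a monotone subsequence for one coordinate after
  another.\<close>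

lemma bounded_family_convergent_subseq:
  fixes t :: "nat \<Rightarrow> nat \<Rightarrow> real"
  assumes "\<forall>m. \<forall>i<n. \<bar>t m i\<bar> \<le> B"
  shows "\<exists>s L. strict_mono s \<and> (\<forall>i<n. (\<lambda>m. t (s m) i) \<longlonglongrightarrow> L i)"
  using assms
proof (induction n)
  case 0
  then show ?case by (auto intro: exI[of _ id] simp: strict_mono_def)
next
  case (Suc n)
  then obtain s L where s: "strict_mono s" and L: "\<forall>i<n. (\<lambda>m. t (s m) i) \<longlonglongrightarrow> L i"
    by (metis less_Suc_eq)
  obtain r where r: "strict_mono r" and mono: "monoseq (\<lambda>m. t (s (r m)) n)"
    using seq_monosub[of "\<lambda>m. t (s m) n"] by blast
  have "Bseq (\<lambda>m. t (s (r m)) n)" using Suc.prems by (intro BseqI'[of _ B]) simp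
  then obtain l where l: "(\<lambda>m. t (s (r m)) n) \<longlonglongrightarrow> l"
    using Bseq_monoseq_convergent[OF _ mono] unfolding convergent_def by blast
  have "(\<lambda>m. t ((s \<circ> r) m) i) \<longlonglongrightarrow> (L(n := l)) i" if "i < Suc n" for i
  proof (cases "i = n")
    case True
    then show ?thesis using l by (simp add: o_def)
  next
    case False
    then have "(\<lambda>m. t (s m) i) \<longlonglongrightarrow> L i" using L that by simp
    from LIMSEQ_subseq_LIMSEQ[OF this r] False show ?thesis by (simp add: o_def)
  qed
  then show ?case using strict_mono_o[OF s r] by blast
qed

lemma LIMSEQ_Ints:
  fixes f :: "nat \<Rightarrow> real"
  assumes "f \<longlonglongrightarrow> L" "\<And>m. f m \<in> \<int>"
  shows "L \<in> \<int>"
proof -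
  obtain M where M: "\<And>m. m \<ge> M \<Longrightarrow> \<bar>f m - f M\<bar> < 1"
    using CauchyD[OF LIMSEQ_imp_Cauchy[OF assms(1)], of 1] by auto
  have "f m = f M" if "m \<ge> M" for m
    using M[OF that] assms(2)[of m] assms(2)[of M] by (auto elim!: Ints_cases)
  then have "eventually (\<lambda>m. f m = f M) sequentially" unfolding eventually_sequentially by blast
  then have "f \<longlonglongrightarrow> f M" by (rule tendsto_eventually)
  from LIMSEQ_unique[OF assms(1) this] show ?thesis using assms(2) by simp
qed

text \<open>Compactness of the coefficient cube: along radii decreasing to \<open>\<rho>\<close> a
  subsequence of the coefficients converges, and integrality of the remainder survives the limit
  because the integers are closed.\<close>

lemma covered_closed:
  assumes "\<And>\<rho>'. \<rho>' > \<rho> \<Longrightarrow> covered D n u \<rho>' y"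
  shows "covered D n u \<rho> y"
proof -
  define p where "p m = \<rho> + inverse (real (Suc m))" for m
  have "\<exists>t. (\<forall>i<n. \<bar>t i\<bar> \<le> 1/2) \<and> (\<forall>j<D. y j - p m * (\<Sum>i<n. t i * u i j) \<in> \<int>)" for m
    using assms[of "p m"] unfolding covered_def p_def by simp
  then obtain t where t: "\<And>m i. i < n \<Longrightarrow> \<bar>t m i\<bar> \<le> 1/2"
    and tz: "\<And>m j. j < D \<Longrightarrow> y j - p m * (\<Sum>i<n. t m i * u i j) \<in> \<int>" by metis
  obtain s L where s: "strict_mono s" and L: "\<forall>i<n. (\<lambda>m. t (s m) i) \<longlonglongrightarrow> L i"
    using bounded_family_convergent_subseq[of n t "1/2"] t by blast
  have "p \<longlonglongrightarrow> \<rho>" unfolding p_def by (rule LIMSEQ_inverse_real_of_nat_add)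
  from LIMSEQ_subseq_LIMSEQ[OF this s] have p: "(\<lambda>m. p (s m)) \<longlonglongrightarrow> \<rho>" by (simp add: o_def)
  have "\<bar>L i\<bar> \<le> 1/2" if "i < n" for i
    using t[OF that] by (intro LIMSEQ_le_const2[OF tendsto_rabs[OF L[rule_format, OF that]]]) auto
  moreover have "y j - \<rho> * (\<Sum>i<n. L i * u i j) \<in> \<int>" if j: "j < D" for j
  proof (rule LIMSEQ_Ints)
    show "(\<lambda>m. y j - p (s m) * (\<Sum>i<n. t (s m) i * u i j)) \<longlonglongrightarrow> y j - \<rho> * (\<Sum>i<n. L i * u i j)"
      using p L by (intro tendsto_intros) auto
    show "y j - p (s m) * (\<Sum>i<n. t (s m) i * u i j) \<in> \<int>" for m
      using tz[OF j] by simp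
  qed
  ultimately show ?thesis by (rule coveredI)
qed

section \<open>Lattice points modulo \<open>N\<close>\<close>

lemma int_lattice_pigeonhole:
  assumes "\<not> at_most_lattice_points d Z (N ^ d)" and "N > 0"
  obtains x y where "x \<in> Z \<inter> int_lattice d" "y \<in> Z \<inter> int_lattice d" "x \<noteq> y"
    "\<And>j. j < d \<Longrightarrow> (y $ j - x $ j) / N \<in> \<int>"
proof -
  let ?S = "Z \<inter> int_lattice d"
  \<comment> \<open>The bound may fail by infinitude as well as by size; a finite subset with one
    point more than there are residue classes serves both cases.\<close>
  obtain S where S: "S \<subseteq> ?S" "finite S" "card S = Suc (N ^ d)"
  proof (cases "finite ?S")
    case True
    then have "Suc (N ^ d) \<le> card ?S" using assms unfolding at_most_lattice_points_def by auto
    then show ?thesis using that obtain_subset_with_card_n by metis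
  next
    case False
    then show ?thesis using that infinite_arbitrarily_large by metis
  qed
  \<comment> \<open>On lattice points the floor is the coordinate itself; \<open>restrict\<close>
    places the residue vectors in a function space with \<open>N ^ d\<close> elements.\<close>
  define f where "f x = restrict (\<lambda>j. \<lfloor>x $ j\<rfloor> mod int N) {..<d}" for x :: "real vec"
  have "f ` S \<subseteq> PiE {..<d} (\<lambda>_. {0..<int N})"
    using assms(2) by (intro image_subsetI PiE_I) (auto simp: f_def)
  then have "card (f ` S) \<le> card (PiE {..<d} (\<lambda>_. {0..<int N}))"
    by (intro card_mono) (auto intro: finite_PiE)
  also have "\<dots> = N ^ d" by (simp add: card_PiE)
  finally have "\<not> inj_on f S" using card_image[of f S] S by auto
  then obtain x y where xy: "x \<in> S" "y \<in> S" "x \<noteq> y" "f x = f y" unfolding inj_on_def by blast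
  have "(y $ j - x $ j) / N \<in> \<int>" if j: "j < d" for j
  proof -
    have "x $ j \<in> \<int>" "y $ j \<in> \<int>" using xy S j unfolding int_lattice_def by auto
    then obtain a b where ab: "x $ j = of_int a" "y $ j = of_int b" by (auto elim!: Ints_cases)
    have "f x j = f y j" using xy by simp
    then have "int N dvd b - a" using j ab by (simp add: f_def mod_eq_dvd_iff[symmetric])
    then obtain k where "b - a = int N * k" by (auto elim: dvdE)
    then have "y $ j - x $ j = real N * of_int k" unfolding ab
      by (metis of_int_diff of_int_mult of_int_of_nat_eq)
    then show ?thesis using assms(2) by simp
  qed
  then show ?thesis using that xy S by blast
qed

section \<open>From \<open>real vec\<close> to coordinate families, and the covering radius\<close>

lemma lin_comb_carrier:
  assumes "\<forall>i<n. u i \<in> carrier_vec d"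
  shows "lin_comb d n c u \<in> carrier_vec d"
  unfolding lin_comb_def using assms by (intro finsum_vec_closed) auto

lemma lin_comb_index:
  assumes "\<forall>i<n. u i \<in> carrier_vec d" and "j < d"
  shows "lin_comb d n c u $ j = (\<Sum>i<n. c i * u i $ j)"
proof -
  have "lin_comb d n c u $ j = (\<Sum>i<n. (c i \<cdot>\<^sub>v u i) $ j)"
    unfolding lin_comb_def using assms by (intro index_finsum_vec) auto
  also have "\<dots> = (\<Sum>i<n. c i * u i $ j)"
  proof (rule sum.cong)
    fix i assume "i \<in> {..<n}"
    then have "j < dim_vec (u i)" using assms by auto
    then show "(c i \<cdot>\<^sub>v u i) $ j = c i * u i $ j" by simp
  qed simp
  finally show ?thesis .
qed

lemma lin_comb_in_span:
  assumes "\<forall>i<n. u i \<in> carrier_vec d"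
  shows "lin_comb d n c u \<in> vspan d (u ` {..<n})"
proof -
  interpret vec_space "TYPE(real)" d .
  have U: "u ` {..<n} \<subseteq> carrier_vec d" using assms by auto
  have "lin_comb d m c u \<in> span (u ` {..<n})" if "m \<le> n" for m
    using that
  proof (induction m)
    case 0
    have "0\<^sub>v d \<in> span (u ` {..<n})" using span_zero by simp
    then show ?case by (simp add: lin_comb_def finsum_vec_empty)
  next
    case (Suc m)
    have "u m \<in> u ` {..<n}" using Suc.prems by auto
    then have "u m \<in> span (u ` {..<n})" using U by (intro span_mem) auto
    then have "c m \<cdot>\<^sub>v u m \<in> span (u ` {..<n})" by (rule smult_in_span[OF U])
    moreover have "lin_comb d m c u \<in> span (u ` {..<n})" using Suc by simp
    ultimately have "c m \<cdot>\<^sub>v u m + lin_comb d m c u \<in> span (u ` {..<n})"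
      using span_add1[of "u ` {..<n}"] U by simp
    moreover have "lin_comb d (Suc m) c u = c m \<cdot>\<^sub>v u m + lin_comb d m c u"
      unfolding lin_comb_def lessThan_Suc using assms Suc.prems by (intro finsum_vec_insert) auto
    ultimately show ?case by simp
  qed
  then show ?thesis by simp
qed

abbreviation coords :: "(nat \<Rightarrow> real vec) \<Rightarrow> nat \<Rightarrow> nat \<Rightarrow> real" where
  "coords u \<equiv> (\<lambda>i j. u i $ j)"

lemma lin_comb_eqI:
  assumes "\<forall>i<n. u i \<in> carrier_vec d" "x \<in> carrier_vec d"
    and "\<And>j. j < d \<Longrightarrow> x $ j = (\<Sum>i<n. c i * u i $ j)"
  shows "lin_comb d n c u = x"
  using lin_comb_carrier[OF assms(1)] assms
  by (intro eq_vecI) (auto simp: lin_comb_index)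

text \<open>Replacing \<open>t\<close> by \<open>t - 1/2\<close> centers the zonotope at the origin;
  the resulting translation is absorbed by quantifying over all points.\<close>

lemma covering_set_iff:
  assumes U: "\<forall>i<n. u i \<in> carrier_vec d"
  shows "{\<rho> \<cdot>\<^sub>v m + z | m z. m \<in> zonotope d n u \<and> z \<in> int_lattice d} = carrier_vec d \<longleftrightarrow>
           (\<forall>y. covered d n (coords u) \<rho> y)"
    (is "?C = _ \<longleftrightarrow> _")
proof
  assume C: "?C = carrier_vec d"
  show "\<forall>y. covered d n (coords u) \<rho> y"
  proof
    fix y :: "nat \<Rightarrow> real"
    let ?y = "vec d (\<lambda>j. y j + \<rho> * (\<Sum>i<n. 1/2 * u i $ j))"
    have "?y \<in> ?C" unfolding C by simp
    then obtain t z where t: "\<forall>i<n. 0 \<le> t i \<and> t i \<le> 1" and z: "z \<in> int_lattice d"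
      and eq: "?y = \<rho> \<cdot>\<^sub>v lin_comb d n t u + z" unfolding zonotope_def by blast
    have "y j - \<rho> * (\<Sum>i<n. (t i - 1/2) * u i $ j) = z $ j" if j: "j < d" for j
    proof -
      have "?y $ j = (\<rho> \<cdot>\<^sub>v lin_comb d n t u + z) $ j" by (simp only: eq)
      moreover have "dim_vec (lin_comb d n t u) = d" using lin_comb_carrier[OF U] by (rule carrier_vecD)
      ultimately show ?thesis
        using j z lin_comb_index[OF U j]
        by (auto simp: int_lattice_def algebra_simps sum_subtractf)
    qed
    moreover have "z $ j \<in> \<int>" if "j < d" for j using z that by (simp add: int_lattice_def)
    moreover have "\<bar>t i - 1/2\<bar> \<le> 1/2" if "i < n" for i using t[rule_format, OF that] by linarith
    ultimately show "covered d n (coords u) \<rho> y"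
      unfolding covered_def by (intro exI[of _ "\<lambda>i. t i - 1/2"]) auto
  qed
next
  assume cov: "\<forall>y. covered d n (coords u) \<rho> y"
  show "?C = carrier_vec d"
  proof
    show "?C \<subseteq> carrier_vec d" using lin_comb_carrier[OF U] by (auto simp: zonotope_def int_lattice_def)
    show "carrier_vec d \<subseteq> ?C"
    proof
      fix x :: "real vec" assume x: "x \<in> carrier_vec d"
      obtain t where t: "\<forall>i<n. \<bar>t i\<bar> \<le> 1/2"
        and tz: "\<forall>j<d. x $ j - \<rho> * (\<Sum>i<n. 1/2 * u i $ j) - \<rho> * (\<Sum>i<n. t i * u i $ j) \<in> \<int>"
        using cov[rule_format, of "\<lambda>j. x $ j - \<rho> * (\<Sum>i<n. 1/2 * u i $ j)"] unfolding covered_def by blast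
      define t' where "t' i = t i + 1/2" for i
      define z where "z = x - \<rho> \<cdot>\<^sub>v lin_comb d n t' u"
      have c: "lin_comb d n t' u \<in> carrier_vec d" by (rule lin_comb_carrier[OF U])
      have "z $ j = x $ j - \<rho> * (\<Sum>i<n. 1/2 * u i $ j) - \<rho> * (\<Sum>i<n. t i * u i $ j)" if "j < d" for j
        using that x c by (simp add: z_def lin_comb_index[OF U] t'_def algebra_simps sum.distrib)
      then have "z $ j \<in> \<int>" if "j < d" for j using tz that by simp
      moreover have "z \<in> carrier_vec d" unfolding z_def using x c by simp
      ultimately have "z \<in> int_lattice d" by (simp add: int_lattice_def)
      moreover have "lin_comb d n t' u \<in> zonotope d n u"
        unfolding zonotope_def t'_def using t by (auto simp: abs_le_iff) (smt (verit) field_sum_of_halves)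
      moreover have "x = \<rho> \<cdot>\<^sub>v lin_comb d n t' u + z"
        using x c by (intro eq_vecI) (auto simp: z_def)
      ultimately show "x \<in> ?C" by blast
    qed
  qed
qed

lemma covering_radius_le:
  assumes "\<forall>i<n. u i \<in> carrier_vec d" "\<rho> > 0" "\<And>y. covered d n (coords u) \<rho> y"
  shows "covering_radius d (zonotope d n u) \<le> \<rho>"
  unfolding covering_radius_def covering_set_iff[OF assms(1)]
  using assms(2,3) by (intro cInf_lower bdd_belowI[of _ 0]) auto

lemma covered_mono:
  assumes "covered D n u \<rho> y" "0 < \<rho>" "\<rho> \<le> \<rho>'"
  shows "covered D n u \<rho>' y"
proof -
  obtain t where t: "\<forall>i<n. \<bar>t i\<bar> \<le> 1/2" "\<forall>j<D. y j - \<rho> * (\<Sum>i<n. t i * u i j) \<in> \<int>"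
    using assms(1) unfolding covered_def by blast
  have "\<rho>' * (\<Sum>i<n. \<rho> / \<rho>' * t i * u i j) = \<rho> * (\<Sum>i<n. t i * u i j)" for j
    using assms by (simp add: sum_distrib_left mult.assoc)
  moreover have "\<bar>\<rho> / \<rho>' * t i\<bar> \<le> 1/2" if "i < n" for i
  proof -
    have "\<bar>\<rho> / \<rho>' * t i\<bar> \<le> 1 * (1/2)"
      unfolding abs_mult using assms t that by (intro mult_mono) auto
    then show ?thesis by simp
  qed
  ultimately show ?thesis using t(2) unfolding covered_def
    by (intro exI[of _ "\<lambda>i. \<rho> / \<rho>' * t i"]) auto
qed

text \<open>Rounding the coefficients of \<open>y\<close> splits off an integral combination of
  lattice vectors. For spanning families this shows that the infimum in
  \<open>covering_radius\<close> is over a nonempty set.\<close>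

lemma covered_1:
  assumes "int_family D n u" "in_span D n u y"
  shows "covered D n u 1 y"
proof -
  obtain c where c: "\<forall>j<D. y j = (\<Sum>i<n. c i * u i j)" using assms(2) unfolding in_span_def by blast
  have "y j - 1 * (\<Sum>i<n. (c i - of_int (round (c i))) * u i j) \<in> \<int>" if j: "j < D" for j
  proof -
    have "y j - 1 * (\<Sum>i<n. (c i - of_int (round (c i))) * u i j) = (\<Sum>i<n. of_int (round (c i)) * u i j)"
      using c j by (simp add: algebra_simps sum_subtractf)
    also have "\<dots> \<in> \<int>" using assms(1) j unfolding int_family_def by (intro Ints_sum Ints_mult) auto
    finally show ?thesis .
  qed
  moreover have "\<bar>c i - of_int (round (c i))\<bar> \<le> 1/2" for i
    using of_int_round_abs_le[of "c i"] by (simp add: abs_minus_commute)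
  ultimately show ?thesis unfolding covered_def by (intro exI[of _ "\<lambda>i. c i - of_int (round (c i))"]) auto
qed

text \<open>Every larger radius exceeds an admissible one and is therefore admissible by
  \<open>covered_mono\<close>; \<open>covered_closed\<close> then reaches \<open>\<rho>\<close>
  itself.\<close>

lemma covered_of_covering_radius_le:
  assumes U: "\<forall>i<n. u i \<in> int_lattice d"
    and span: "\<And>x. in_span d n (coords u) x"
    and le: "covering_radius d (zonotope d n u) \<le> \<rho>"
  shows "covered d n (coords u) \<rho> y"
proof (rule covered_closed)
  fix \<rho>' assume "\<rho>' > \<rho>"
  have C: "\<forall>i<n. u i \<in> carrier_vec d" using U by (simp add: int_lattice_def)
  have int: "int_family d n (coords u)" using U by (simp add: int_family_def int_lattice_def)
  let ?S = "{\<rho>. \<rho> > 0 \<and> (\<forall>y. covered d n (coords u) \<rho> y)}"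
  have "Inf ?S < \<rho>'"
    using le \<open>\<rho>' > \<rho>\<close> unfolding covering_radius_def covering_set_iff[OF C] by simp
  moreover have "\<forall>y. covered d n (coords u) 1 y" using covered_1[OF int span] by blast
  then have "1 \<in> ?S" by simp
  ultimately obtain \<sigma> where "\<sigma> \<in> ?S" "\<sigma> < \<rho>'" using cInf_lessD[of ?S \<rho>'] by blast
  then show "covered d n (coords u) \<rho>' y" using covered_mono[of d n "coords u" \<sigma> y \<rho>'] by auto
qed

lemma spanning_covers_of_cosimple:
  assumes "\<And>n u. cosimple D n u \<Longrightarrow> covering_radius D (zonotope D n u) \<le> \<rho>"
  shows "spanning_covers D \<rho>"
  unfolding spanning_covers_def
proof (intro allI impI, elim conjE)
  fix n u c y
  assume int: "int_family D n u" and span: "\<forall>x. in_span D n u x" and dep: "dependence D n u c"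
    and inj: "inj_on (\<lambda>i. \<bar>c i\<bar>) {..<n}"
  define U where "U i = vec D (u i)" for i
  have U: "\<forall>i<n. U i \<in> carrier_vec D" by (simp add: U_def)
  have UL: "\<forall>i<n. U i \<in> int_lattice D"
    using int by (simp add: U_def int_lattice_def int_family_def)
  have cov: "covered D n (coords U) = covered D n u"
    unfolding covered_def U_def by (intro ext) (simp cong: sum.cong)
  have spU: "in_span D n (coords U) = in_span D n u"
    unfolding in_span_def U_def by (intro ext) (simp cong: sum.cong)
  have "cosimple D n U"
    unfolding cosimple_def
  proof (intro conjI exI[of _ c])
    interpret vec_space "TYPE(real)" D .
    have "x \<in> span (U ` {..<n})" if x: "x \<in> carrier_vec D" for x
    proof -
      obtain b where "\<forall>j<D. x $ j = (\<Sum>i<n. b i * U i $ j)"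
        using span[rule_format, of "\<lambda>j. x $ j"] unfolding spU[symmetric] in_span_def by blast
      then have "lin_comb D n b U = x" using x U by (intro lin_comb_eqI) auto
      then show ?thesis using lin_comb_in_span[OF U, of b] by simp
    qed
    moreover have "U ` {..<n} \<subseteq> carrier_vec D" using U by auto
    ultimately show "span (U ` {..<n}) = carrier_vec D" using span_closed by auto
    show "lin_comb D n c U = 0\<^sub>v D"
      using U dep by (intro lin_comb_eqI) (auto simp: dependence_def U_def)
    show "\<forall>i<n. c i \<noteq> 0" using dep by (simp add: dependence_def)
  qed (use UL inj in auto)
  then have "covering_radius D (zonotope D n U) \<le> \<rho>" by (rule assms)
  from covered_of_covering_radius_le[OF UL _ this] show "covered D n u \<rho> y"
    using span unfolding cov spU by blast
qed

section \<open>Long lattice segments and projections\<close>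

text \<open>A tuple is lifted through the section \<open>e\<close>, expanded in the generators
  upstairs, and projected back.\<close>

lemma projected_in_span:
  assumes q: "quotient_data d m w r a e" and span: "\<And>x. in_span d n u x"
  shows "in_span r n (\<lambda>i k. dotp d (a k) (u i)) x"
proof -
  obtain c where c: "\<forall>j<d. (\<Sum>l<r. x l * e l j) = (\<Sum>i<n. c i * u i j)"
    using span[of "\<lambda>j. \<Sum>l<r. x l * e l j"] unfolding in_span_def by blast
  have "x k = (\<Sum>i<n. c i * dotp d (a k) (u i))" if k: "k < r" for k
  proof -
    have "(\<Sum>i<n. c i * dotp d (a k) (u i)) = dotp d (a k) (\<lambda>j. \<Sum>l<r. x l * e l j)"
      unfolding dotp_sum[symmetric] using c by (intro dotp_cong) simp
    also have "\<dots> = (\<Sum>l<r. if k = l then x l else 0)"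
      unfolding dotp_sum using q k unfolding quotient_data_def by (intro sum.cong) auto
    also have "\<dots> = x k" using k by simp
    finally show ?thesis by simp
  qed
  then show ?thesis unfolding in_span_def by (intro exI[of _ c]) simp
qed

lemma projected_int_family:
  assumes "quotient_data d m w r a e" "int_family d n u"
  shows "int_family r n (\<lambda>i k. dotp d (a k) (u i))"
  using assms unfolding int_family_def quotient_data_def by (auto intro!: dotp_Ints)

text \<open>The coefficients are literally the same, so distinct absolute values persist under
  projection.\<close>

lemma projected_dependence:
  assumes "dependence d n u c"
  shows "dependence r n (\<lambda>i k. dotp d (a k) (u i)) c"
proof -
  have "(\<Sum>i<n. c i * dotp d (a k) (u i)) = 0" for k
  proof -
    have "(\<Sum>i<n. c i * dotp d (a k) (u i)) = dotp d (a k) (\<lambda>j. \<Sum>i<n. c i * u i j)"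
      by (rule dotp_sum[symmetric])
    also have "\<dots> = 0" using assms by (simp add: dependence_def dotp_def)
    finally show ?thesis .
  qed
  then show ?thesis using assms by (simp add: dependence_def)
qed

text \<open>Here \<open>\<alpha>\<close> is the difference of the coefficients of two lattice points
  congruent modulo \<open>N\<close>, and \<open>w\<close> is their difference divided by
  \<open>N\<close>. It is nonzero but may be a multiple of a shorter lattice vector.\<close>

lemma long_lattice_segment:
  assumes U: "\<forall>i<n. u i \<in> carrier_vec d" and N: "N > 0"
    and big: "\<not> at_most_lattice_points d (zonotope d n u) (N ^ d)"
  obtains w \<alpha> a e where "\<forall>j<d. w j \<in> \<int>" "\<forall>i<n. \<bar>\<alpha> i\<bar> \<le> 1"
    "\<forall>j<d. (\<Sum>i<n. \<alpha> i * u i $ j) = real N * w j"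
    "quotient_data d 1 (\<lambda>_. w) (d - 1) a e"
proof -
  obtain x y where x: "x \<in> zonotope d n u \<inter> int_lattice d" and y: "y \<in> zonotope d n u \<inter> int_lattice d"
    and "x \<noteq> y" and w: "\<And>j. j < d \<Longrightarrow> (y $ j - x $ j) / N \<in> \<int>"
    using int_lattice_pigeonhole[OF big N] by metis
  define w where "w j = (y $ j - x $ j) / N" for j
  obtain s t where s: "\<forall>i<n. 0 \<le> s i \<and> s i \<le> 1" "x = lin_comb d n s u"
    and t: "\<forall>i<n. 0 \<le> t i \<and> t i \<le> 1" "y = lin_comb d n t u"
    using x y unfolding zonotope_def by auto
  have "(\<Sum>i<n. (t i - s i) * u i $ j) = real N * w j" if j: "j < d" for j
  proof -
    have "(\<Sum>i<n. (t i - s i) * u i $ j) = y $ j - x $ j"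
      unfolding s(2) t(2) lin_comb_index[OF U j] by (simp add: left_diff_distrib sum_subtractf)
    then show ?thesis using N by (simp add: w_def)
  qed
  moreover have "\<bar>t i - s i\<bar> \<le> 1" if "i < n" for i
    using s(1)[rule_format, OF that] t(1)[rule_format, OF that] by (auto simp: abs_le_iff)
  moreover have "\<exists>a e. quotient_data d (Suc 0) (\<lambda>_. w) (d - 1) a e"
  \<comment> \<open>The empty family has all \<open>d\<close> coordinate functionals; adjoining the
    nonzero \<open>w\<close> removes one.\<close>
  proof (rule quotient_data_Suc[OF quotient_data_0])
    show "w j \<in> \<int>" if "j < d" for j using w[OF that] by (simp add: w_def)
    have "dim_vec x = d" "dim_vec y = d" using x y by (auto simp: int_lattice_def)
    with \<open>x \<noteq> y\<close> obtain j where "j < d" "x $ j \<noteq> y $ j" by (metis eq_vecI)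
    then show "\<not> in_span d 0 (\<lambda>_. w) w" using N by (auto simp: in_span_def w_def)
  qed
  ultimately show ?thesis using that[of w "\<lambda>i. t i - s i"] w unfolding w_def by auto
qed

section \<open>Spanning and dependence of the two kinds of generators\<close>

lemma velocity_generators_in_span:
  assumes "velocity_generators d v u"
  shows "in_span d (d + 1) (coords u) x"
proof -
  have U: "\<forall>i<d+1. u i \<in> carrier_vec d"
    using assms by (auto simp: velocity_generators_def int_lattice_def)
  \<comment> \<open>Unit vectors are lattice points, hence combinations of the generators; real
    multiples of them then give every vector.\<close>
  have "\<exists>c. unit_vec d l = lin_comb d (d + 1) c u" if l: "l < d" for l
  proof -
    have "unit_vec d l \<in> int_lattice d" by (auto simp: int_lattice_def unit_vec_def)
    then show ?thesis using assms unfolding velocity_generators_def by blast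
  qed
  then obtain c where c: "\<And>l. l < d \<Longrightarrow> unit_vec d l = lin_comb d (d + 1) (c l) u" by metis
  have unit: "(\<Sum>i<d+1. c l i * u i $ j) = (if j = l then 1 else 0)" if "l < d" "j < d" for l j
    using lin_comb_index[OF U, where c = "c l" and j = j] that unfolding c[OF that(1), symmetric] by simp
  have "(\<Sum>i<d+1. (\<Sum>l<d. x l * c l i) * u i $ j) = x j" if j: "j < d" for j
  proof -
    have "(\<Sum>i<d+1. (\<Sum>l<d. x l * c l i) * u i $ j) = (\<Sum>l<d. x l * (\<Sum>i<d+1. c l i * u i $ j))"
      unfolding sum_distrib_left sum_distrib_right by (subst sum.swap) (simp add: mult.assoc)
    also have "\<dots> = (\<Sum>l<d. if l = j then x l else 0)"
    proof (rule sum.cong)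
      fix l assume "l \<in> {..<d}"
      then have "l < d" by simp
      show "x l * (\<Sum>i<d+1. c l i * u i $ j) = (if l = j then x l else 0)"
        unfolding unit[OF \<open>l < d\<close> j] by simp
    qed simp
    also have "\<dots> = x j" using j by simp
    finally show ?thesis .
  qed
  then show ?thesis unfolding in_span_def by (intro exI[of _ "\<lambda>i. \<Sum>l<d. x l * c l i"]) simp
qed

text \<open>Independence concerns sets of vectors; injectivity on \<open>J\<close> lets the
  coefficients of the family be read as a function on the set of its members.\<close>

lemma vlin_indpt_family_coeff_zero:
  assumes U: "u ` J \<subseteq> carrier_vec d" and J: "finite J" "inj_on u J" "vlin_indpt d (u ` J)"
    and z: "\<And>j. j < d \<Longrightarrow> (\<Sum>i\<in>J. c i * u i $ j) = 0" and i: "i \<in> J"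
  shows "c i = 0"
proof -
  interpret vec_space "TYPE(real)" d .
  define b where "b x = c (inv_into J u x)" for x
  have b: "b (u i) = c i" if "i \<in> J" for i using that J by (simp add: b_def)
  have "lincomb b (u ` J) = 0\<^sub>v d"
  proof (rule eq_vecI)
    show "dim_vec (lincomb b (u ` J)) = dim_vec (0\<^sub>v d)" using lincomb_dim U J by simp
    fix j assume "j < dim_vec (0\<^sub>v d :: real vec)"
    then have j: "j < d" by simp
    have "lincomb b (u ` J) $ j = (\<Sum>x\<in>u ` J. b x * x $ j)" by (rule lincomb_index[OF j U])
    also have "\<dots> = (\<Sum>i\<in>J. c i * u i $ j)" using J b by (simp add: sum.reindex)
    finally show "lincomb b (u ` J) $ j = 0\<^sub>v d $ j" using z[OF j] j by simp
  qed
  then have "b \<in> u ` J \<rightarrow> {0}" using not_lindepD[OF J(3), of "u ` J" b] J by simp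
  from funcset_mem[OF this, of "u i"] show ?thesis using b[OF i] i by simp
qed

text \<open>The first \<open>d\<close> generators form a basis, and expanding the last one in it
  gives the dependence. A vanishing coefficient would leave a relation among \<open>d\<close>
  generators.\<close>

lemma lonely_runner_dependence:
  assumes L: "lonely_runner_generators d u"
  shows "\<exists>c. dependence d (d + 1) (coords u) c"
proof -
  interpret vec_space "TYPE(real)" d .
  have U: "\<forall>i<d+1. u i \<in> carrier_vec d"
    using L by (auto simp: lonely_runner_generators_def int_lattice_def)
  have ind: "inj_on u J" "vlin_indpt d (u ` J)" if "J \<subseteq> {..<d+1}" "card J = d" for J
    using L that unfolding lonely_runner_generators_def by auto
  let ?A = "u ` {..<d}"
  have A: "?A \<subseteq> carrier_vec d" using U by auto
  have inj: "inj_on u {..<d}" using ind(1)[of "{..<d}"] by auto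
  have "lin_indpt ?A" using ind(2)[of "{..<d}"] by auto
  then have "basis ?A"
    using A inj by (intro dim_li_is_basis) (auto simp: dim_is_n card_image)
  then have "u d \<in> span ?A" using U unfolding basis_def by auto
  then obtain b where b: "u d = lincomb b ?A"
    using finite_span[of ?A] A by auto
  define c where "c i = (if i < d then b (u i) else - 1)" for i
  have dep: "(\<Sum>i<d+1. c i * u i $ j) = 0" if j: "j < d" for j
  proof -
    have "u d $ j = (\<Sum>x\<in>?A. b x * x $ j)" using lincomb_index[OF j A, of b] b by simp
    also have "\<dots> = (\<Sum>i<d. c i * u i $ j)" using inj by (simp add: sum.reindex c_def)
    finally show ?thesis by (simp add: c_def)
  qed
  have "c i \<noteq> 0" if i: "i < d + 1" for i
  proof
    assume ci: "c i = 0"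
    let ?J = "{..<d+1} - {i}"
    \<comment> \<open>Index \<open>d\<close> has coefficient -1, so it survives in
      \<open>?J\<close>, where independence would make that coefficient 0.\<close>
    have "i \<noteq> d" using ci by (auto simp: c_def)
    have J: "?J \<subseteq> {..<d+1}" "card ?J = d" using i by auto
    have "c d = 0"
    proof (rule vlin_indpt_family_coeff_zero[OF _ _ ind[OF J]])
      show "(\<Sum>i\<in>?J. c i * u i $ j) = 0" if "j < d" for j
        using dep[OF that] i ci by (subst (asm) sum.remove[of _ i]) auto
      show "u ` ?J \<subseteq> carrier_vec d" using U by auto
      show "d \<in> ?J" using \<open>i \<noteq> d\<close> by auto
    qed simp
    then show False by (simp add: c_def)
  qed
  then show ?thesis using dep unfolding dependence_def by (intro exI[of _ c]) simp
qed

lemma choose_two_step: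
  shows "(real d - 1) / (real d + 1) + 1 / real ((d + 2) choose 2) = real d / (real d + 2)"
proof -
  \<comment> \<open>Evenness makes the integer division in \<open>choose_two\<close> exact over the
    reals.\<close>
  have "even ((d + 2) * (d + 1))" by simp
  then have "real ((d + 2) choose 2) = (real d + 2) * (real d + 1) / 2"
    by (simp add: choose_two real_of_nat_div algebra_simps)
  moreover have "(x - 1) / (x + 1) + 1 / ((x + 2) * (x + 1) / 2) = x / (x + 2)" if "x \<ge> 0" for x :: real
    using that by (simp add: divide_simps) (simp add: algebra_simps)
  ultimately show ?thesis by (metis of_nat_0_le_iff)
qed

theorem corollary1p10:
  fixes d :: nat
  assumes "d \<ge> 1"
    and "\<And>n u. cosimple (d - 1) n u \<Longrightarrow>
           covering_radius (d - 1) (zonotope (d - 1) n u) \<le> (real d - 1) / (real d + 1)"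
  shows "(\<forall>Z. strong_lonely_runner_zonotope d Z \<and>
              covering_radius d Z > real d / (real d + 2) \<longrightarrow>
              at_most_lattice_points d Z (((d + 2) choose 2) ^ d)) \<and>
         (\<forall>Z x. lonely_runner_zonotope d Z x \<and>
              {(real d / (real d + 2)) \<cdot>\<^sub>v (z - x) | z. z \<in> Z} \<inter>
                {x + y | y. y \<in> int_lattice d} = {} \<longrightarrow>
              at_most_lattice_points d Z (((d + 2) choose 2) ^ d))"
proof -
  let ?N = "(d + 2) choose 2" and ?\<rho> = "(real d - 1) / (real d + 1)" and ?\<sigma> = "real d / (real d + 2)"
  have H: "spanning_covers (d - 1) ?\<rho>" using assms(2) by (rule spanning_covers_of_cosimple)
  have N: "?N > 0" by simp
  have \<rho>: "?\<rho> \<ge> 0" and \<sigma>: "?\<sigma> > 0" using assms(1) by auto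
  note step = choose_two_step[of d]
  show ?thesis
  proof (intro conjI allI impI; elim conjE)
    fix Z
    assume "strong_lonely_runner_zonotope d Z" and mu: "covering_radius d Z > ?\<sigma>"
    then obtain v u where v: "\<forall>i<d+1. v i > 0" "inj_on v {..<d+1}"
      and gen: "velocity_generators d v u" and Z: "Z = zonotope d (d+1) u"
      unfolding strong_lonely_runner_zonotope_def by blast
    have UL: "\<forall>i<d+1. u i \<in> int_lattice d" using gen by (auto simp: velocity_generators_def)
    then have U: "\<forall>i<d+1. u i \<in> carrier_vec d" by (auto simp: int_lattice_def)
    have int: "int_family d (d+1) (coords u)" using UL by (auto simp: int_family_def int_lattice_def)
    let ?c = "\<lambda>i. real_of_int (v i)"
    have "(\<Sum>i<d+1. ?c i * u i $ j) = 0" if "j < d" for j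
      using lin_comb_index[OF U that, where c = ?c] gen that by (simp add: velocity_generators_def)
    then have dep: "dependence d (d+1) (coords u) ?c" using v(1) by (auto simp: dependence_def dest: spec)
    have inj: "inj_on (\<lambda>i. \<bar>?c i\<bar>) {..<d+1}"
    proof (rule inj_onI)
      fix i l assume *: "i \<in> {..<d+1}" "l \<in> {..<d+1}" "\<bar>?c i\<bar> = \<bar>?c l\<bar>"
      then have "v i > 0" "v l > 0" using v(1) by auto
      then have "v i = v l" using *(3) by simp
      then show "i = l" using inj_onD[OF v(2)] *(1,2) by blast
    qed
    show "at_most_lattice_points d Z (?N ^ d)"
    proof (rule ccontr)
      assume "\<not> at_most_lattice_points d Z (?N ^ d)"
      then obtain w \<alpha> a e where w: "\<forall>j<d. w j \<in> \<int>" and \<alpha>: "\<forall>i<d+1. \<bar>\<alpha> i\<bar> \<le> 1"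
        "\<forall>j<d. (\<Sum>i<d+1. \<alpha> i * u i $ j) = real ?N * w j"
        and q: "quotient_data d 1 (\<lambda>_. w) (d - 1) a e"
        using long_lattice_segment[OF U N] unfolding Z by blast
      have "covered (d - 1) (d + 1) (\<lambda>i k. dotp d (a k) (coords u i)) ?\<rho> y" for y
        using H projected_int_family[OF q int] projected_dependence[OF dep] inj
          projected_in_span[OF q velocity_generators_in_span[OF gen]]
        unfolding spanning_covers_def by blast
      then have "covered d (d + 1) (coords u) (?\<rho> + 1 / real ?N) y" for y
        using N \<rho> by (intro covered_lift[OF q w _ _ \<alpha>]) auto
      then have "covering_radius d Z \<le> ?\<sigma>"
        unfolding Z step using U \<sigma> by (intro covering_radius_le) auto
      then show False using mu by simp
    qed
  next
    fix Z x
    assume "lonely_runner_zonotope d Z x"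
      and disj: "{?\<sigma> \<cdot>\<^sub>v (z - x) | z. z \<in> Z} \<inter> {x + y | y. y \<in> int_lattice d} = {}"
    then obtain u where gen: "lonely_runner_generators d u" and Z: "Z = zonotope d (d+1) u"
      and x: "x = zonotope_center d (d+1) u"
      unfolding lonely_runner_zonotope_def by blast
    have UL: "\<forall>i<d+1. u i \<in> int_lattice d" using gen by (auto simp: lonely_runner_generators_def)
    then have U: "\<forall>i<d+1. u i \<in> carrier_vec d" by (auto simp: int_lattice_def)
    have int: "int_family d (d+1) (coords u)" using UL by (auto simp: int_family_def int_lattice_def)
    obtain c where dep: "dependence d (d+1) (coords u) c" using lonely_runner_dependence[OF gen] by blast
    show "at_most_lattice_points d Z (?N ^ d)"
    proof (rule ccontr)
      assume "\<not> at_most_lattice_points d Z (?N ^ d)"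
      then obtain w \<alpha> a e where w: "\<forall>j<d. w j \<in> \<int>" and \<alpha>: "\<forall>i<d+1. \<bar>\<alpha> i\<bar> \<le> 1"
        "\<forall>j<d. (\<Sum>i<d+1. \<alpha> i * u i $ j) = real ?N * w j"
        and q: "quotient_data d 1 (\<lambda>_. w) (d - 1) a e"
        using long_lattice_segment[OF U N] unfolding Z by blast
      \<comment> \<open>The center of \<open>Z\<close>, with the factor 1/2 inside the sum to match
        \<open>dotp_sum\<close>; its projection is the center of the projected zonotope, as
        \<open>covered_center\<close> requires.\<close>
      define y where "y = (\<lambda>j. \<Sum>i<d+1. 1/2 * u i $ j)"
      have y: "dotp d (a k) y = (\<Sum>i<d+1. dotp d (a k) (coords u i)) / 2" for k
      proof -
        have "dotp d (a k) y = (\<Sum>i<d+1. 1/2 * dotp d (a k) (coords u i))"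
          unfolding y_def by (rule dotp_sum)
        then show ?thesis unfolding sum_distrib_left[symmetric] by simp
      qed
      have "covered (d - 1) (d + 1) (\<lambda>i k. dotp d (a k) (coords u i)) ?\<rho> (\<lambda>k. dotp d (a k) y)"
        unfolding y using covered_center[OF H projected_int_family[OF q int] projected_dependence[OF dep]] .
      then have "covered d (d + 1) (coords u) (?\<rho> + 1 / real ?N) y"
        using N \<rho> by (intro covered_lift[OF q w _ _ \<alpha>]) auto
      then obtain t where t: "\<forall>i<d+1. \<bar>t i\<bar> \<le> 1/2"
        and tz: "\<forall>j<d. y j - ?\<sigma> * (\<Sum>i<d+1. t i * u i $ j) \<in> \<int>"
        unfolding step covered_def by blast
      \<comment> \<open>Undoing the centering gives a point of \<open>Z\<close> whose offset from
        \<open>x\<close> is the combination with coefficients \<open>t\<close>.\<close>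
      define z where "z = lin_comb d (d+1) (\<lambda>i. t i + 1/2) u"
      have "0 \<le> t i + 1/2 \<and> t i + 1/2 \<le> 1" if "i < d + 1" for i
        using t[rule_format, OF that] by (auto simp: abs_le_iff)
      then have zZ: "z \<in> Z" unfolding Z z_def zonotope_def by blast
      have zc: "z \<in> carrier_vec d" unfolding z_def by (rule lin_comb_carrier[OF U])
      have xc: "x \<in> carrier_vec d" unfolding x zonotope_center_def using lin_comb_carrier[OF U] by simp
      have xj: "x $ j = y j" if j: "j < d" for j
        using lin_comb_index[OF U j, where c = "\<lambda>_. 1"] lin_comb_carrier[OF U, where c = "\<lambda>_. 1"] j
        unfolding x zonotope_center_def y_def sum_distrib_left[symmetric] by simp
      have zj: "z $ j - y j = (\<Sum>i<d+1. t i * u i $ j)" if j: "j < d" for j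
        unfolding z_def y_def lin_comb_index[OF U j] distrib_right sum.distrib by simp
      let ?p = "?\<sigma> \<cdot>\<^sub>v (z - x)"
      \<comment> \<open>The scaled point differs from \<open>x\<close> by minus the integral
        remainder of the covering, so it lies in both of the sets assumed disjoint.\<close>
      have "(?p - x) $ j \<in> \<int>" if j: "j < d" for j
      proof -
        have "(?p - x) $ j = - (y j - ?\<sigma> * (\<Sum>i<d+1. t i * u i $ j))"
          using j zc xc by (simp add: xj zj)
        then show ?thesis using tz j by (simp only: Ints_minus)
      qed
      then have "?p - x \<in> int_lattice d" using zc xc by (simp add: int_lattice_def)
      moreover have "?p = x + (?p - x)" using zc xc by (intro eq_vecI) auto
      ultimately have "?p \<in> {x + y | y. y \<in> int_lattice d}" by blast
      moreover have "?p \<in> {?\<sigma> \<cdot>\<^sub>v (z - x) | z. z \<in> Z}" using zZ by blast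
      ultimately show False using disj by blast
    qed
  qed
qed

end
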